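(* Let $X$ be a non-negative absolutely continuous random variable with mean $\mu$ and (finite) variance $\sigma^2$, $\sigma>0$. Then the cumulative residual entropy of $X$ satisfies $$\mathcal{E}(X)\leq \sum_{n=1}^{+\infty}\frac{\sigma}{(n+1)\sqrt{2n+1}}\simeq 1.21\,\sigma,$$ where $\simeq$ denotes the approximate numerical value of the series.
   Context: $\log$ is the natural logarithm, with the convention $0\log 0=0$. The cumulative residual entropy of a non-negative absolutely continuous random variable $X$ with cumulative distribution function $F$ is $\mathcal{E}(X)=-\int_0^{+\infty}(1-F(x))\log(1-F(x))\,dx$. *)

theory Defs
  imports "HOL-Probability.Probability"
begin

text \<open>Since \<open>ln 0 = 0\<close> (and in any case \<open>0 * ln 0 = 0\<close>), the convention \<open>0 log 0 = 0\<close> holds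
  automatically.\<close>

definition cre_integrand :: "'a measure \<Rightarrow> ('a \<Rightarrow> real) \<Rightarrow> real \<Rightarrow> real" where
  "cre_integrand M X x =
     (1 - cdf (distr M borel X) x) * ln (1 - cdf (distr M borel X) x)"

text \<open>The integrand is nonpositive. The Bochner integral of a non-integrable function is \<open>0\<close>, so
  this real number is the cumulative residual entropy only when \<^const>\<open>cre_integrand\<close> is integrable
  on \<open>{0..}\<close>; otherwise the cumulative residual entropy is infinite.\<close>

definition cumulative_residual_entropy :: "'a measure \<Rightarrow> ('a \<Rightarrow> real) \<Rightarrow> real" where
  "cumulative_residual_entropy M X = - (LBINT x:{0..}. cre_integrand M X x)"

end

theory Submission
  imports Defs "HOL-Real_Asymp.Real_Asymp"
begin

text \<open>
  Let \<open>F\<close> be the distribution function of \<open>X\<close> and let \<open>Y = -ln (1 - F(X))\<close> be its cumulative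
  hazard, evaluated at \<open>X\<close> itself. As \<open>F\<close> is continuous, \<open>F(X)\<close> is uniform on the unit interval and
  \<open>Y\<close> is exponentially distributed with rate 1 (\<open>cumulative_hazard_exponential\<close>). Its centred tail
  expectations are \<open>E[(Y - 1); Y > y] = y exp (-y)\<close>. With \<open>y = -ln (1 - F x)\<close> the right-hand side is
  the negated entropy integrand at \<open>x\<close>, and the event \<open>Y > y\<close> is almost surely the event \<open>X > x\<close>; hence
  \<open>-(1 - F x) ln (1 - F x) = E[(Y - 1); X > x]\<close> (\<open>cre_integrand_eq_tail_expectation\<close>).

  Integrating over \<open>x \<ge> 0\<close> by Fubini's theorem (\<open>layer_cake_weighted\<close>) exhibits the cumulative residual
  entropy as a covariance: it equals \<open>E[X (Y - 1)] = E[(X - \<mu>) (Y - 1)]\<close>. Both variances are known, namely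
  \<open>\<sigma>^2\<close> and 1, so Cauchy-Schwarz yields the bound \<open>\<sigma>\<close>
  (\<open>cumulative_residual_entropy_le_std\<close>).
  This is sharper than the bound by the series, whose value is about \<open>1.21 \<sigma>\<close>.

  It remains to locate the value of the series
  (\<open>suminf_bound_term_bounds\<close>). The first seven terms are bounded by hand,
  and the tail is trapped between two telescoping series built from
  \<open>2 / sqrt (2 n + c)\<close>. The lower estimate of the series also exceeds 1, which turns the bound
  \<open>\<sigma>\<close> into the bound by the series.
\<close>

section \<open>The cumulative hazard of a variable with continuous distribution function\<close>

lemma (in prob_space) borel_measurable_cdf_distr:
  fixes X :: "'a \<Rightarrow> real"
  assumes "random_variable borel X"
  shows "cdf (distr M borel X) \<in> borel_measurable borel"
proof -
  interpret D: real_distribution "distr M borel X"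
    by (rule real_distribution_distr) fact
  show ?thesis
    by (rule borel_measurable_mono) (simp add: mono_def D.cdf_nondecreasing)
qed

text \<open>The probability integral transform: \<open>F(X)\<close> is uniform on the unit interval. The distribution
  function \<open>F\<close> may be flat at the level \<open>u\<close>, so that \<open>{F(X) \<le> u}\<close> need not be of the form
  \<open>{X \<le> c}\<close>. It contains \<open>{X \<le> c}\<close> when \<open>F c = u\<close> and lies inside \<open>{X \<le> c}\<close> when
  \<open>F c = v > u\<close>, and letting \<open>v\<close> decrease to \<open>u\<close> squeezes its probability.\<close>
lemma (in prob_space) prob_cdf_le:
  fixes X :: "'a \<Rightarrow> real"
  assumes X[measurable]: "random_variable borel X"
    and cont: "\<And>x. isCont (cdf (distr M borel X)) x"
    and u: "0 \<le> u" "u < 1"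
  shows "prob {\<omega> \<in> space M. cdf (distr M borel X) (X \<omega>) \<le> u} = u"
proof -
  define F where "F = cdf (distr M borel X)"
  interpret D: real_distribution "distr M borel X"
    by (rule real_distribution_distr) (rule X)
  have F_mono: "F x \<le> F y" if "x \<le> y" for x y
    unfolding F_def using that by (rule D.cdf_nondecreasing)
  have [measurable]: "F \<in> borel_measurable borel"
    unfolding F_def by (rule borel_measurable_cdf_distr[OF X])
  have F_prob: "prob {\<omega> \<in> space M. X \<omega> \<le> c} = F c" for c
    by (auto simp: F_def cdf_def measure_distr intro!: arg_cong[where f=prob])
  \<comment> \<open>Only here does continuity enter: without it \<open>F\<close> may jump over \<open>v\<close>.\<close>
  have F_onto: "\<exists>c. F c = v" if v: "0 < v" "v < 1" for v
  proof -
    obtain a where a: "F a < v"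
      using order_tendstoD(2)[OF D.cdf_lim_at_bot v(1)] 
      by (auto simp: F_def eventually_at_bot_linorder)
    obtain b where b: "v < F b"
      using order_tendstoD(1)[OF D.cdf_lim_at_top_prob v(2)] 
      by (auto simp: F_def eventually_at_top_linorder)
    have "a \<le> b"
      using a b F_mono[of b a] by linarith
    then show ?thesis
      using IVT[of F a v b] a b cont by (auto simp: F_def)
  qed
  have upper: "prob {\<omega> \<in> space M. F (X \<omega>) \<le> u} \<le> v" if v: "u < v" "v < 1" for v
  proof -
    obtain c where c: "F c = v" using F_onto[of v] u v by auto
    have "prob {\<omega> \<in> space M. F (X \<omega>) \<le> u} \<le> prob {\<omega> \<in> space M. X \<omega> \<le> c}"
    proof (rule finite_measure_mono)
      show "{\<omega> \<in> space M. F (X \<omega>) \<le> u} \<subseteq> {\<omega> \<in> space M. X \<omega> \<le> c}"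
        using F_mono c v by (auto, meson leD le_cases order.strict_trans1)
    qed measurable
    then show ?thesis by (simp add: F_prob c)
  qed
  have "prob {\<omega> \<in> space M. F (X \<omega>) \<le> u} \<le> u"
    by (rule dense_ge_bounded[OF u(2)]) (rule upper)
  moreover have "u \<le> prob {\<omega> \<in> space M. F (X \<omega>) \<le> u}"
    \<comment> \<open>The level 0 is set apart because \<open>F\<close> may be positive everywhere.\<close>
  proof (cases "u = 0")
    case False
    then obtain c where c: "F c = u" using F_onto[of u] u by auto
    have "prob {\<omega> \<in> space M. X \<omega> \<le> c} \<le> prob {\<omega> \<in> space M. F (X \<omega>) \<le> u}"
    proof (rule finite_measure_mono)
      show "{\<omega> \<in> space M. X \<omega> \<le> c} \<subseteq> {\<omega> \<in> space M. F (X \<omega>) \<le> u}"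
        using F_mono c by auto
    qed measurable
    then show ?thesis by (simp add: F_prob c)
  qed simp
  ultimately show ?thesis by (simp add: F_def)
qed

text \<open>Where \<open>F(X) = 1\<close>, the hazard \<open>-ln (1 - F(X))\<close> takes the default value \<open>-ln 0 = 0\<close> instead
  of \<open>\<infinity>\<close>; this happens with probability 0 only.\<close>
lemma (in prob_space) AE_cdf_less_1:
  fixes X :: "'a \<Rightarrow> real"
  assumes X[measurable]: "random_variable borel X"
    and cont: "\<And>x. isCont (cdf (distr M borel X)) x"
  shows "AE \<omega> in M. cdf (distr M borel X) (X \<omega>) < 1"
proof -
  define F where "F = cdf (distr M borel X)"
  interpret D: real_distribution "distr M borel X"
    by (rule real_distribution_distr) (rule X)
  have [measurable]: "F \<in> borel_measurable borel"
    unfolding F_def by (rule borel_measurable_cdf_distr[OF X])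
  have "u \<le> prob {\<omega> \<in> space M. F (X \<omega>) < 1}" if u: "0 < u" "u < 1" for u
  proof -
    have "u = prob {\<omega> \<in> space M. F (X \<omega>) \<le> u}"
      using prob_cdf_le[OF X cont] u by (simp add: F_def)
    also have "\<dots> \<le> prob {\<omega> \<in> space M. F (X \<omega>) < 1}"
      using u by (intro finite_measure_mono) auto
    finally show ?thesis .
  qed
  then have "1 \<le> prob {\<omega> \<in> space M. F (X \<omega>) < 1}"
    by (rule dense_le_bounded[OF zero_less_one])
  then have "prob {\<omega> \<in> space M. F (X \<omega>) < 1} = 1"
    using prob_le_1 by (intro antisym)
  then show ?thesis
    using prob_Collect_eq_1[of "\<lambda>\<omega>. F (X \<omega>) < 1"] unfolding F_def[symmetric] by simp
qed

text \<open>If \<open>U\<close> is uniform on the unit interval, then \<open>-ln (1 - U)\<close> is exponential with rate 1. This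
  is where all dependence on the law of \<open>X\<close> disappears.\<close>
lemma (in prob_space) cumulative_hazard_exponential:
  fixes X :: "'a \<Rightarrow> real"
  assumes X[measurable]: "random_variable borel X"
    and cont: "\<And>x. isCont (cdf (distr M borel X)) x"
  shows "distributed M lborel (\<lambda>\<omega>. - ln (1 - cdf (distr M borel X) (X \<omega>))) (exponential_density 1)"
proof -
  define F where "F = cdf (distr M borel X)"
  interpret D: real_distribution "distr M borel X"
    by (rule real_distribution_distr) (rule X)
  have [measurable]: "F \<in> borel_measurable borel"
    unfolding F_def by (rule borel_measurable_cdf_distr[OF X])
  have "distributed M lborel (\<lambda>\<omega>. - ln (1 - F (X \<omega>))) (exponential_density 1)"
    unfolding exponential_distributed_iff[OF zero_less_one]
  proof (intro conjI allI impI)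
    fix a :: real assume a: "0 \<le> a"
    have "prob {\<omega> \<in> space M. - ln (1 - F (X \<omega>)) \<le> a} = prob {\<omega> \<in> space M. F (X \<omega>) \<le> 1 - exp (- a)}"
    proof (rule prob_eq_AE)
      show "AE \<omega> in M. (- ln (1 - F (X \<omega>)) \<le> a) = (F (X \<omega>) \<le> 1 - exp (- a))"
        using AE_cdf_less_1[OF X cont]
      proof eventually_elim
        case (elim \<omega>)
        then have "(- a \<le> ln (1 - F (X \<omega>))) = (exp (- a) \<le> 1 - F (X \<omega>))"
          by (intro ln_ge_iff) (simp add: F_def)
        then show ?case by linarith
      qed
    qed measurable
    also have "\<dots> = 1 - exp (- a)"
      using prob_cdf_le[OF X cont, of "1 - exp (- a)"] a by (simp add: F_def)
    finally show "prob {\<omega> \<in> space M. - ln (1 - F (X \<omega>)) \<le> a} = 1 - exp (- a * 1)"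
      by simp
  qed measurable
  then show ?thesis by (simp add: F_def)
qed

section \<open>The entropy as a covariance\<close>

text \<open>The function \<open>-t exp (-t)\<close> is a primitive of the integrand \<open>(t - 1) exp (-t)\<close>. Since
  \<open>Y - 1\<close> has mean 0, its expectation over the tail is minus that over the compact interval
  \<open>{0..y}\<close>, where the fundamental theorem of calculus applies although the integrand changes sign.\<close>
lemma (in prob_space) exponential_centred_tail_expectation:
  fixes Y :: "'a \<Rightarrow> real"
  assumes D: "distributed M lborel Y (exponential_density 1)" and y: "0 \<le> y"
  shows "expectation (\<lambda>\<omega>. indicator {y<..} (Y \<omega>) * (Y \<omega> - 1)) = y * exp (- y)"
proof -
  have Y[measurable]: "random_variable borel Y"
    using distributed_measurable[OF D] by simp
  have Y_int[simp]: "integrable M Y"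
    using erlang_ith_moment_integrable[OF _ D, of 1] by simp
  have mean: "expectation (\<lambda>\<omega>. Y \<omega> - 1) = 0"
    using exponential_distributed_expectation[OF _ D] by (simp add: prob_space)
  have "expectation (\<lambda>\<omega>. indicator {..y} (Y \<omega>) * (Y \<omega> - 1))
      = (\<integral>t. exponential_density 1 t * (indicator {..y} t * (t - 1)) \<partial>lborel)"
    by (subst distributed_integral[OF D]) auto
  also have "\<dots> = (\<integral>t. indicator {0..y} t *\<^sub>R ((t - 1) * exp (- t)) \<partial>lborel)"
    by (intro Bochner_Integration.integral_cong)
       (auto simp: exponential_density_def split: split_indicator)
  also have "\<dots> = (- y * exp (- y)) - (- 0 * exp (- 0))"
    using y
    by (intro integral_FTC_atLeastAtMost)
       (auto intro!: derivative_eq_intros continuous_intros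
         simp: has_real_derivative_iff_has_vector_derivative[symmetric] algebra_simps)
  finally have below: "expectation (\<lambda>\<omega>. indicator {..y} (Y \<omega>) * (Y \<omega> - 1)) = - y * exp (- y)"
    by simp
  have int: "integrable M (\<lambda>\<omega>. indicator {..y} (Y \<omega>) * (Y \<omega> - 1))"
    by (rule Bochner_Integration.integrable_bound[where f="\<lambda>\<omega>. Y \<omega> - 1"])
       (auto split: split_indicator)
  have "expectation (\<lambda>\<omega>. indicator {y<..} (Y \<omega>) * (Y \<omega> - 1))
      = expectation (\<lambda>\<omega>. (Y \<omega> - 1) - indicator {..y} (Y \<omega>) * (Y \<omega> - 1))"
    by (intro Bochner_Integration.integral_cong) (auto split: split_indicator)
  also have "\<dots> = y * exp (- y)"
    using int by (subst Bochner_Integration.integral_diff) (simp_all only: mean below, auto)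
  finally show ?thesis .
qed

text \<open>Let \<open>Y\<close> be the cumulative hazard at \<open>X\<close> and \<open>y\<close> its value at \<open>x\<close>. Because the hazard
  is monotone, \<open>{Y > y}\<close> is contained in \<open>{X > x}\<close> up to a null set; both have probability
  \<open>exp (-y) = 1 - F x\<close>, so they agree almost surely. The previous lemma then evaluates the tail
  expectation of \<open>Y - 1\<close> as \<open>y exp (-y)\<close>, which is \<open>-(1 - F x) ln (1 - F x)\<close>.\<close>
lemma (in prob_space) cre_integrand_eq_tail_expectation:
  fixes X :: "'a \<Rightarrow> real"
  assumes X[measurable]: "random_variable borel X"
    and cont: "\<And>x. isCont (cdf (distr M borel X)) x"
  shows "cre_integrand M X x
    = - expectation (\<lambda>\<omega>. indicator {x<..} (X \<omega>) * (- ln (1 - cdf (distr M borel X) (X \<omega>)) - 1))"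
proof -
  define F where "F = cdf (distr M borel X)"
  interpret D: real_distribution "distr M borel X"
    by (rule real_distribution_distr) (rule X)
  have F_mono: "F s \<le> F t" if "s \<le> t" for s t
    unfolding F_def using that by (rule D.cdf_nondecreasing)
  have [measurable]: "F \<in> borel_measurable borel"
    unfolding F_def by (rule borel_measurable_cdf_distr[OF X])
  define Y where "Y = (\<lambda>\<omega>. - ln (1 - F (X \<omega>)))"
  have Y[measurable]: "random_variable borel Y"
    by (simp add: Y_def)
  have Yexp: "distributed M lborel Y (exponential_density 1)"
    unfolding Y_def F_def by (rule cumulative_hazard_exponential[OF X cont])
  have tail: "prob {\<omega> \<in> space M. x < X \<omega>} = 1 - F x"
  proof -
    have "prob {\<omega> \<in> space M. X \<omega> \<le> x} = F x"
      by (auto simp: F_def cdf_def measure_distr intro!: arg_cong[where f=prob])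
    moreover have "{\<omega> \<in> space M. x < X \<omega>} = space M - {\<omega> \<in> space M. X \<omega> \<le> x}" by auto
    ultimately show ?thesis by (simp add: prob_compl)
  qed
  show ?thesis
  proof (cases "F x < 1")
    case True
    define y where "y = - ln (1 - F x)"
    have exp_y: "exp (- y) = 1 - F x" using True by (simp add: y_def)
    have "0 \<le> y"
      using True D.cdf_nonneg[of x] by (simp add: y_def F_def)
    have sub: "AE \<omega> in M. y < Y \<omega> \<longrightarrow> x < X \<omega>"
      using AE_cdf_less_1[OF X cont]
    proof eventually_elim
      case (elim \<omega>)
      show ?case
      proof
        assume "y < Y \<omega>"
        then have "ln (1 - F (X \<omega>)) < ln (1 - F x)" by (simp add: Y_def y_def)
        then have "F x < F (X \<omega>)"
          using elim True by (simp add: F_def)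
        then show "x < X \<omega>"
          using F_mono[of "X \<omega>" x] by linarith
      qed
    qed
    have pY: "prob {\<omega> \<in> space M. y < Y \<omega>} = 1 - F x"
      using exponential_distributedD_gt[OF Yexp \<open>0 \<le> y\<close>] exp_y by simp
    have "prob {\<omega> \<in> space M. x < X \<omega> \<and> \<not> y < Y \<omega>} = 0"
    proof -
      have "prob {\<omega> \<in> space M. x < X \<omega>}
          = prob {\<omega> \<in> space M. x < X \<omega> \<and> y < Y \<omega>} + prob {\<omega> \<in> space M. x < X \<omega> \<and> \<not> y < Y \<omega>}"
        by (subst finite_measure_Union[symmetric]) (auto intro!: arg_cong[where f=prob])
      moreover have "prob {\<omega> \<in> space M. x < X \<omega> \<and> y < Y \<omega>} = prob {\<omega> \<in> space M. y < Y \<omega>}"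
        using sub by (intro prob_eq_AE) auto
      ultimately show ?thesis using tail pY by simp
    qed
    then have "AE \<omega> in M. \<not> (x < X \<omega> \<and> \<not> y < Y \<omega>)"
      by (subst (asm) prob_eq_0) auto
    with sub have "AE \<omega> in M. indicator {x<..} (X \<omega>) * (Y \<omega> - 1) = indicator {y<..} (Y \<omega>) * (Y \<omega> - 1)"
      by eventually_elim (auto split: split_indicator)
    then have "expectation (\<lambda>\<omega>. indicator {x<..} (X \<omega>) * (Y \<omega> - 1))
        = expectation (\<lambda>\<omega>. indicator {y<..} (Y \<omega>) * (Y \<omega> - 1))"
      by (intro integral_cong_AE) auto
    also have "\<dots> = y * exp (- y)"
      by (rule exponential_centred_tail_expectation[OF Yexp \<open>0 \<le> y\<close>])
    also have "\<dots> = - cre_integrand M X x"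
      unfolding exp_y by (simp add: y_def cre_integrand_def F_def)
    finally show ?thesis by (simp add: Y_def F_def)
  next
    case False
    then have F1: "F x = 1" using D.cdf_bounded_prob[of x] by (simp add: F_def)
    with tail have "prob {\<omega> \<in> space M. x < X \<omega>} = 0" by simp
    then have "AE \<omega> in M. \<not> x < X \<omega>"
      by (subst (asm) prob_eq_0) auto
    then have "AE \<omega> in M. indicator {x<..} (X \<omega>) * (Y \<omega> - 1) = 0"
      by eventually_elim auto
    then have "expectation (\<lambda>\<omega>. indicator {x<..} (X \<omega>) * (Y \<omega> - 1)) = 0"
      by (rule integral_eq_zero_AE)
    then show ?thesis using F1 by (simp add: cre_integrand_def Y_def F_def)
  qed
qed

text \<open>Write \<open>X\<close> as the length of \<open>{0..<X}\<close> and exchange the two integrations. The weight \<open>Z\<close> may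
  change sign, so Fubini's theorem needs the integrability of \<open>X Z\<close>; it gives in return
  the integrability of the tail expectations of \<open>Z\<close>.\<close>
lemma (in prob_space) layer_cake_weighted:
  fixes X Z :: "'a \<Rightarrow> real"
  assumes X[measurable]: "random_variable borel X" and nonneg: "AE \<omega> in M. 0 \<le> X \<omega>"
    and Z: "integrable M Z" and XZ: "integrable M (\<lambda>\<omega>. X \<omega> * Z \<omega>)"
  shows "set_integrable lborel {0..} (\<lambda>x. expectation (\<lambda>\<omega>. indicator {x<..} (X \<omega>) * Z \<omega>))"
    and "(LBINT x:{0..}. expectation (\<lambda>\<omega>. indicator {x<..} (X \<omega>) * Z \<omega>))
      = expectation (\<lambda>\<omega>. X \<omega> * Z \<omega>)"
proof -
  have [measurable]: "random_variable borel Z" using Z by auto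
  interpret P: pair_sigma_finite M lborel ..
  define f where "f = (\<lambda>(\<omega>, x). (if 0 \<le> x \<and> x < X \<omega> then Z \<omega> else 0))"
  have f_meas[measurable]: "f \<in> borel_measurable (M \<Otimes>\<^sub>M lborel)"
    unfolding f_def by measurable
  have f_ind: "f (\<omega>, x) = indicator {0..<X \<omega>} x * Z \<omega>" for \<omega> x
    by (simp add: f_def split: split_indicator)
  have f_int: "integrable (M \<Otimes>\<^sub>M lborel) f"
  proof (rule P.Fubini_integrable)
    have "integrable M (\<lambda>\<omega>. norm (X \<omega> * Z \<omega>))" using XZ by (rule integrable_norm)
    moreover have "AE \<omega> in M. norm (X \<omega> * Z \<omega>) = (\<integral>x. norm (f (\<omega>, x)) \<partial>lborel)"
      using nonneg by eventually_elim (simp add: f_ind abs_mult)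
    ultimately show "integrable M (\<lambda>\<omega>. \<integral>x. norm (f (\<omega>, x)) \<partial>lborel)"
      by (subst integrable_cong_AE[symmetric]) auto
    show "AE \<omega> in M. integrable lborel (\<lambda>x. f (\<omega>, x))"
      unfolding f_ind
    proof (intro AE_I2 integrable_mult_left integrable_real_indicator)
      fix \<omega>
      have "emeasure lborel {0..<X \<omega>} \<le> emeasure lborel {0..\<bar>X \<omega>\<bar>}"
        by (intro emeasure_mono) auto
      then show "emeasure lborel {0..<X \<omega>} < \<infinity>"
        by (simp add: order.strict_trans1)
    qed auto
  qed auto
  have slice: "(\<integral>\<omega>. f (\<omega>, x) \<partial>M)
      = indicator {0..} x *\<^sub>R expectation (\<lambda>\<omega>. indicator {x<..} (X \<omega>) * Z \<omega>)" for x
    by (auto simp: f_def split: split_indicator intro!: Bochner_Integration.integral_cong)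
  show "set_integrable lborel {0..} (\<lambda>x. expectation (\<lambda>\<omega>. indicator {x<..} (X \<omega>) * Z \<omega>))"
    using P.integrable_snd[of "\<lambda>\<omega> x. f (\<omega>, x)"] f_int
    by (simp add: set_integrable_def slice)
  have "(LBINT x:{0..}. expectation (\<lambda>\<omega>. indicator {x<..} (X \<omega>) * Z \<omega>))
      = (\<integral>x. (\<integral>\<omega>. f (\<omega>, x) \<partial>M) \<partial>lborel)"
    by (simp add: set_lebesgue_integral_def slice)
  also have "\<dots> = (\<integral>\<omega>. (\<integral>x. f (\<omega>, x) \<partial>lborel) \<partial>M)"
    using f_int by (intro P.Fubini_integral) simp
  also have "\<dots> = expectation (\<lambda>\<omega>. X \<omega> * Z \<omega>)"
  proof (rule integral_cong_AE)
    show "AE \<omega> in M. (\<integral>x. f (\<omega>, x) \<partial>lborel) = X \<omega> * Z \<omega>"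
      using nonneg by eventually_elim (simp add: f_ind)
  qed auto
  finally show "(LBINT x:{0..}. expectation (\<lambda>\<omega>. indicator {x<..} (X \<omega>) * Z \<omega>))
      = expectation (\<lambda>\<omega>. X \<omega> * Z \<omega>)" .
qed

text \<open>The two preceding lemmas make the entropy equal to \<open>E[X (Y - 1)]\<close>, and as \<open>E[Y] = 1\<close> this is
  the covariance of \<open>X\<close> and \<open>Y\<close>. An exponential variable of rate 1 has variance 1, so the
  Cauchy-Schwarz inequality bounds the covariance by \<open>\<sigma>\<close>.\<close>
lemma (in prob_space) cumulative_residual_entropy_le_std:
  fixes X :: "'a \<Rightarrow> real"
  assumes X[measurable]: "random_variable borel X" and nonneg: "AE \<omega> in M. 0 \<le> X \<omega>"
    and cont: "\<And>x. isCont (cdf (distr M borel X)) x"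
    and X_int: "integrable M X" and X_sq: "integrable M (\<lambda>\<omega>. (X \<omega> - expectation X)\<^sup>2)"
    and var: "variance X = \<sigma>\<^sup>2" and \<sigma>: "\<sigma> > 0"
  shows "set_integrable lborel {0..} (cre_integrand M X)"
    and "cumulative_residual_entropy M X \<le> \<sigma>"
proof -
  define Y where "Y = (\<lambda>\<omega>. - ln (1 - cdf (distr M borel X) (X \<omega>)))"
  define \<mu> where "\<mu> = expectation X"
  have Yexp: "distributed M lborel Y (exponential_density 1)"
    unfolding Y_def by (rule cumulative_hazard_exponential[OF X cont])
  have [measurable]: "random_variable borel Y"
    using distributed_measurable[OF Yexp] by simp
  have Y_int: "integrable M Y"
    using erlang_ith_moment_integrable[OF _ Yexp, of 1] by simp
  have "integrable M (\<lambda>\<omega>. (Y \<omega>)\<^sup>2)"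
    using erlang_ith_moment_integrable[OF _ Yexp, of 2] by simp
  then have Y_sq: "integrable M (\<lambda>\<omega>. (Y \<omega> - 1)\<^sup>2)"
    using Y_int by (simp add: power2_diff)
  have Y_mean: "expectation Y = 1"
    using exponential_distributed_expectation[OF _ Yexp] by simp
  have Y_var: "expectation (\<lambda>\<omega>. (Y \<omega> - 1)\<^sup>2) = 1"
    using exponential_distributed_variance[OF _ Yexp] by (simp add: Y_mean)
  \<comment> \<open>Cauchy-Schwarz in the form of the inequality between arithmetic and geometric mean, weighted so
    that both squares contribute \<open>\<sigma>\<close>; the same bound \<open>?B\<close> gives integrability of the product.\<close>
  let ?B = "\<lambda>\<omega>. ((X \<omega> - \<mu>)\<^sup>2 / \<sigma> + \<sigma> * (Y \<omega> - 1)\<^sup>2) / 2"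
  have amgm: "\<bar>a * b\<bar> \<le> (a\<^sup>2 / \<sigma> + \<sigma> * b\<^sup>2) / 2" for a b :: real
  proof -
    have "0 \<le> (\<bar>a\<bar> - \<sigma> * \<bar>b\<bar>)\<^sup>2 / \<sigma>" using \<sigma> by simp
    also have "\<dots> = a\<^sup>2 / \<sigma> + \<sigma> * b\<^sup>2 - 2 * \<bar>a * b\<bar>"
      using \<sigma> by (simp add: power2_diff field_simps power2_eq_square abs_mult)
    finally show ?thesis by simp
  qed
  have B_int: "integrable M ?B"
    using X_sq Y_sq by (simp add: \<mu>_def)
  have prod_int: "integrable M (\<lambda>\<omega>. (X \<omega> - \<mu>) * (Y \<omega> - 1))"
  proof (rule Bochner_Integration.integrable_bound[OF B_int])
    show "AE \<omega> in M. norm ((X \<omega> - \<mu>) * (Y \<omega> - 1)) \<le> norm (?B \<omega>)"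
      using amgm by (intro AE_I2) (simp add: order.trans[OF _ abs_ge_self])
  qed simp
  have split: "X \<omega> * (Y \<omega> - 1) = (X \<omega> - \<mu>) * (Y \<omega> - 1) + \<mu> * (Y \<omega> - 1)" for \<omega>
    by (simp add: algebra_simps)
  have XZ: "integrable M (\<lambda>\<omega>. X \<omega> * (Y \<omega> - 1))"
    unfolding split using prod_int Y_int by simp
  have Z: "integrable M (\<lambda>\<omega>. Y \<omega> - 1)" using Y_int by simp
  have cre: "cre_integrand M X = (\<lambda>x. - expectation (\<lambda>\<omega>. indicator {x<..} (X \<omega>) * (Y \<omega> - 1)))"
    unfolding Y_def by (rule ext) (rule cre_integrand_eq_tail_expectation[OF X cont])
  note layer = layer_cake_weighted[OF X nonneg Z XZ]
  show "set_integrable lborel {0..} (cre_integrand M X)"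
    using layer(1) by (simp add: cre set_integrable_def)
  have "cumulative_residual_entropy M X = expectation (\<lambda>\<omega>. X \<omega> * (Y \<omega> - 1))"
    using layer(2) by (simp add: cumulative_residual_entropy_def cre set_lebesgue_integral_def)
  also have "\<dots> = expectation (\<lambda>\<omega>. (X \<omega> - \<mu>) * (Y \<omega> - 1))"
    unfolding split using prod_int Y_int by (simp add: Y_mean prob_space)
  also have "\<dots> \<le> expectation ?B"
    using amgm by (intro integral_mono[OF prod_int B_int]) (metis abs_le_D1)
  also have "\<dots> = (\<sigma>\<^sup>2 / \<sigma> + \<sigma> * 1) / 2"
    using X_sq Y_sq var by (simp add: \<mu>_def Y_var)
  also have "\<dots> = \<sigma>" by (simp add: power2_eq_square)
  finally show "cumulative_residual_entropy M X \<le> \<sigma>" .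
qed

text \<open>Points are Lebesgue null sets, so \<open>X\<close> has no atoms.\<close>
lemma isCont_cdf_absolutely_continuous:
  fixes X :: "'a \<Rightarrow> real"
  assumes "prob_space M" and X[measurable]: "X \<in> borel_measurable M"
    and ac: "absolutely_continuous lborel (distr M borel X)"
  shows "isCont (cdf (distr M borel X)) x"
proof -
  interpret prob_space M by fact
  interpret D: real_distribution "distr M borel X"
    by (rule real_distribution_distr) (rule X)
  have "{x} \<in> null_sets lborel" by (simp add: null_sets_def)
  then have "{x} \<in> null_sets (distr M borel X)"
    using ac by (auto simp: absolutely_continuous_def)
  then show ?thesis
    by (simp add: D.isCont_cdf measure_def null_sets_def)
qed

section \<open>The numerical value of the series\<close>

abbreviation bound_term :: "nat \<Rightarrow> real" where
  "bound_term n \<equiv> 1 / ((real (Suc n) + 1) * sqrt (2 * real (Suc n) + 1))"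

text \<open>The terms decay like \<open>n powr (-3/2)\<close>, so that partial sums alone converge too slowly. The tails
  are enclosed between telescoping sums of \<open>2 / sqrt (2 n + c)\<close> with \<open>c = 3\<close> (from below) and
  \<open>c = 5/2\<close> (from above). Writing \<open>m = 2 n + 3\<close> for the number under the root, the term is
  \<open>4 / (2 (m + 1) sqrt m)\<close>, to be compared with the differences computed next.\<close>
lemma inverse_sqrt_step:
  fixes t :: real assumes "0 < t"
  shows "2 / sqrt t - 2 / sqrt (t + 2) = 4 / (sqrt t * sqrt (t + 2) * (sqrt t + sqrt (t + 2)))"
proof -
  have p: "0 < sqrt t" "0 < sqrt (t + 2)" using assms by auto
  have key: "(sqrt (t + 2) - sqrt t) * (sqrt t + sqrt (t + 2)) = 2"
    using assms by (simp add: algebra_simps flip: power2_eq_square)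
  have "2 / a - 2 / b = 2 * ((b - a) * (a + b)) / (a * b * (a + b))" if "0 < a" "0 < b" for a b :: real
  proof -
    have "2 / a - 2 / b = 2 * (b - a) / (a * b)"
      using that by (simp add: field_simps)
    also have "\<dots> = (2 * (b - a)) * (a + b) / ((a * b) * (a + b))"
      using that by simp
    finally show ?thesis by (simp only: mult.assoc)
  qed
  from this[OF p] show ?thesis by (simp add: key)
qed

lemma bound_term_eq:
  assumes "m = 2 * real n + 3"
  shows "bound_term n = 4 / (2 * (m + 1) * sqrt m)"
proof -
  have "real (Suc n) + 1 = (m + 1) / 2" "2 * real (Suc n) + 1 = m" by (simp_all add: assms)
  then have "bound_term n = 1 / ((m + 1) / 2 * sqrt m)" by (simp only:)
  also have "\<dots> = (2 * 2) / (2 * ((m + 1) * sqrt m))"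
    by (subst mult_divide_mult_cancel_left) auto
  also have "\<dots> = 4 / (2 * (m + 1) * sqrt m)"
    by (simp add: mult.assoc del: distrib_left_numeral)
  finally show ?thesis .
qed

text \<open>With \<open>t = m\<close> the denominator of the difference is
  \<open>sqrt m (sqrt m sqrt (m + 2) + m + 2)\<close>, and \<open>sqrt m sqrt (m + 2) \<ge> m\<close>.\<close>
lemma bound_term_ge_step: "2 / sqrt (2 * real n + 3) - 2 / sqrt (2 * real (Suc n) + 3) \<le> bound_term n"
proof -
  define m where "m = 2 * real n + 3"
  have m: "0 < m" by (simp add: m_def)
  have s: "sqrt m * sqrt m = m" "sqrt (m + 2) * sqrt (m + 2) = m + 2" using m by auto
  have "m \<le> sqrt m * sqrt (m + 2)"
    using m real_sqrt_le_mono[of m "m + 2"] mult_left_mono[of "sqrt m" "sqrt (m + 2)" "sqrt m"] s by simp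
  then have "sqrt m * (2 * (m + 1)) \<le> sqrt m * (sqrt m * sqrt (m + 2) + (m + 2))"
    using m by (intro mult_left_mono) auto
  also have "\<dots> = sqrt m * sqrt (m + 2) * (sqrt m + sqrt (m + 2))"
    using m by (simp add: algebra_simps)
  finally have "4 / (sqrt m * sqrt (m + 2) * (sqrt m + sqrt (m + 2))) \<le> 4 / (sqrt m * (2 * (m + 1)))"
    using m by (intro divide_left_mono) (auto intro!: mult_pos_pos add_pos_pos)
  also have "\<dots> = bound_term n"
    unfolding bound_term_eq[OF m_def] by (simp only: mult_ac)
  finally show ?thesis
    using inverse_sqrt_step[OF m] by (simp add: m_def algebra_simps)
qed

text \<open>Here \<open>t = m - 1/2\<close> and \<open>t + 2 = m + 3/2\<close> have arithmetic mean \<open>m + 1/2\<close>. So the product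
  \<open>?P\<close> of their roots is at most \<open>m + 1/2\<close>, the sum \<open>?S\<close> of their roots is at most
  \<open>2 sqrt (m + 1/2)\<close>, and it remains to see that \<open>(m + 1/2)^3 \<le> (m + 1)^2 m\<close>, which
  holds as \<open>m \<ge> 3\<close>.\<close>
lemma bound_term_le_step: "bound_term n \<le> 2 / sqrt (2 * real n + 5/2) - 2 / sqrt (2 * real (Suc n) + 5/2)"
proof -
  define m where "m = 2 * real n + 3"
  define t where "t = 2 * real n + 5/2"
  have m: "3 \<le> m" by (simp add: m_def)
  have t: "0 < t" and tm: "t + 2 = m + 3/2" "t = m - 1/2" by (simp_all add: m_def t_def)
  let ?P = "sqrt t * sqrt (t + 2)" and ?S = "sqrt t + sqrt (t + 2)"
  have s: "(sqrt t)\<^sup>2 = t" "(sqrt (t + 2))\<^sup>2 = t + 2" using t by auto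
  have "?P\<^sup>2 \<le> (m + 1/2)\<^sup>2"
    unfolding power_mult_distrib s by (simp add: tm power2_eq_square algebra_simps)
  moreover have "?S\<^sup>2 \<le> 4 * (m + 1/2)"
  proof -
    have "2 * sqrt t * sqrt (t + 2) \<le> t + (t + 2)"
      using sum_squares_bound[of "sqrt t" "sqrt (t + 2)"] unfolding s .
    then show ?thesis unfolding power2_sum s by (simp add: tm)
  qed
  ultimately have "(?P * ?S)\<^sup>2 \<le> (m + 1/2)\<^sup>2 * (4 * (m + 1/2))"
    unfolding power_mult_distrib by (intro mult_mono) auto
  also have "\<dots> \<le> (2 * (m + 1))\<^sup>2 * m"
    using m mult_mono[of 3 m 3 m] by (simp add: power2_eq_square algebra_simps)
  also have "\<dots> = (2 * (m + 1) * sqrt m)\<^sup>2"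
    using m by (simp add: power_mult_distrib)
  finally have "?P * ?S \<le> 2 * (m + 1) * sqrt m"
    by (rule power2_le_imp_le) (use m in auto)
  then have "4 / (2 * (m + 1) * sqrt m) \<le> 4 / (?P * ?S)"
    using m t by (intro divide_left_mono) (auto intro!: mult_pos_pos add_pos_pos)
  moreover have "bound_term n = 4 / (2 * (m + 1) * sqrt m)"
    by (rule bound_term_eq[OF m_def])
  ultimately show ?thesis
    using inverse_sqrt_step[OF t] by (simp add: t_def algebra_simps)
qed

lemma inverse_sqrt_telescope:
  fixes c :: real assumes "0 < c"
  shows "(\<lambda>n. 2 / sqrt (2 * real (n + k) + c) - 2 / sqrt (2 * real (Suc (n + k)) + c))
    sums (2 / sqrt (2 * real k + c))"
proof -
  have "(\<lambda>n. 2 / sqrt (2 * real (n + k) + c)) \<longlonglongrightarrow> 0"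
    by real_asymp
  from telescope_sums'[OF this] show ?thesis by simp
qed

lemma summable_bound_term: "summable bound_term"
proof (rule summable_comparison_test')
  show "summable (\<lambda>n. 2 / sqrt (2 * real n + 5/2) - 2 / sqrt (2 * real (Suc n) + 5/2))"
    using inverse_sqrt_telescope[of "5/2" 0] by (auto dest: sums_summable)
  show "norm (bound_term n) \<le> 2 / sqrt (2 * real n + 5/2) - 2 / sqrt (2 * real (Suc n) + 5/2)" for n
    using bound_term_le_step[of n] by simp
qed

lemma le_inverse_sqrt:
  fixes x l :: real
  assumes "0 < x" "0 \<le> l" "l\<^sup>2 * x \<le> 1"
  shows "l \<le> 1 / sqrt x"
proof -
  have "sqrt (l\<^sup>2 * x) \<le> 1" using assms by simp
  then show ?thesis using assms by (simp add: real_sqrt_mult field_simps)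
qed

lemma inverse_sqrt_le:
  fixes x u :: real
  assumes "0 < x" "0 \<le> u" "1 \<le> u\<^sup>2 * x"
  shows "1 / sqrt x \<le> u"
proof -
  have "1 \<le> sqrt (u\<^sup>2 * x)" using assms by simp
  then show ?thesis using assms by (simp add: real_sqrt_mult field_simps)
qed

text \<open>Seven terms are summed separately: the enclosure of the remaining tail, between
  \<open>2 / sqrt 17\<close> and \<open>2 / sqrt (33/2)\<close>, is then narrow enough for the window of width
  \<open>1/100\<close>, while six terms would leave the lower bound less than \<open>2/10000\<close> to spare.\<close>
lemma suminf_bound_term_bounds: "241/200 < suminf bound_term" "suminf bound_term < 243/200"
proof -
  define r :: "real \<Rightarrow> real" where "r x = 1 / sqrt x" for x
  define T where "T = (\<Sum>n. bound_term (n + 7))"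
  have split: "suminf bound_term = T + (\<Sum>n<7. bound_term n)"
    unfolding T_def by (rule suminf_split_initial_segment[OF summable_bound_term])
  have tail_summable: "summable (\<lambda>n. bound_term (n + 7))"
    using summable_bound_term by (rule summable_ignore_initial_segment)
  have T_ge: "2 * r 17 \<le> T"
    using suminf_le[OF bound_term_ge_step sums_summable[OF inverse_sqrt_telescope] tail_summable]
      sums_unique[OF inverse_sqrt_telescope[of 3 7]]
    by (simp add: T_def r_def)
  have T_le: "T \<le> 2 * r (33/2)"
    using suminf_le[OF bound_term_le_step tail_summable sums_summable[OF inverse_sqrt_telescope]]
      sums_unique[OF inverse_sqrt_telescope[of "5/2" 7]]
    by (simp add: T_def r_def)
  have head: "(\<Sum>n<7. bound_term n) = r 3 / 2 + r 5 / 3 + r 7 / 4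
      + 1 / 15 + r 11 / 6 + r 13 / 7 + r 15 / 8"
  proof -
    have "sqrt 9 = 3" by (rule real_sqrt_unique) auto
    then show ?thesis by (simp add: eval_nat_numeral r_def)
  qed
  have lower: "5773/10000 \<le> r 3" "4472/10000 \<le> r 5" "3779/10000 \<le> r 7"
    "3015/10000 \<le> r 11" "2773/10000 \<le> r 13" "2581/10000 \<le> r 15"
    "2425/10000 \<le> r 17"
    unfolding r_def by (rule le_inverse_sqrt; simp add: power2_eq_square)+
  have upper: "r 3 \<le> 5774/10000" "r 5 \<le> 4473/10000" "r 7 \<le> 3780/10000"
    "r 11 \<le> 3016/10000" "r 13 \<le> 2774/10000" "r 15 \<le> 2582/10000"
    "r (33/2) \<le> 2462/10000"
    unfolding r_def by (rule inverse_sqrt_le; simp add: power2_eq_square)+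
  show "241/200 < suminf bound_term" "suminf bound_term < 243/200"
    using lower upper T_ge T_le unfolding split head by linarith+
qed

theorem theorem1:
  fixes M :: "'a measure" and X :: "'a \<Rightarrow> real" and \<mu> \<sigma> :: real
  assumes "prob_space M"
    and "X \<in> borel_measurable M"
    and "AE \<omega> in M. 0 \<le> X \<omega>"
    and "absolutely_continuous lborel (distr M borel X)"
    and "integrable M X"
    and "prob_space.expectation M X = \<mu>"
    and "integrable M (\<lambda>\<omega>. (X \<omega> - \<mu>)\<^sup>2)"
    and "prob_space.variance M X = \<sigma>\<^sup>2"
    and "\<sigma> > 0"
  shows "set_integrable lborel {0..} (cre_integrand M X)
    \<and> summable (\<lambda>n. \<sigma> / ((real (Suc n) + 1) * sqrt (2 * real (Suc n) + 1)))
    \<and> cumulative_residual_entropy M X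
        \<le> (\<Sum>n. \<sigma> / ((real (Suc n) + 1) * sqrt (2 * real (Suc n) + 1)))
    \<and> \<bar>(\<Sum>n. \<sigma> / ((real (Suc n) + 1) * sqrt (2 * real (Suc n) + 1))) - 1.21 * \<sigma>\<bar> < 0.005 * \<sigma>"
proof -
  interpret prob_space M by fact
  have cont: "isCont (cdf (distr M borel X)) x" for x
    by (rule isCont_cdf_absolutely_continuous) fact+
  have sq: "integrable M (\<lambda>\<omega>. (X \<omega> - expectation X)\<^sup>2)"
    using assms by simp
  note cre = cumulative_residual_entropy_le_std[OF assms(2,3) cont assms(5) sq assms(8,9)]
  define S where "S = suminf bound_term"
  have scaled: "(\<lambda>n. \<sigma> / ((real (Suc n) + 1) * sqrt (2 * real (Suc n) + 1))) sums (\<sigma> * S)"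
    using sums_mult[OF summable_sums[OF summable_bound_term], of \<sigma>] by (simp add: S_def)
  have S: "241/200 < S" "S < 243/200" unfolding S_def by (rule suminf_bound_term_bounds)+
  have "\<sigma> * (241/200) < \<sigma> * S" "\<sigma> * S < \<sigma> * (243/200)"
    using S \<open>\<sigma> > 0\<close> by (intro mult_strict_left_mono; simp)+
  then have "\<sigma> \<le> \<sigma> * S" "\<bar>\<sigma> * S - 121/100 * \<sigma>\<bar> < 1/200 * \<sigma>"
    using \<open>\<sigma> > 0\<close> unfolding abs_less_iff by linarith+
  then show ?thesis
    using cre sums_summable[OF scaled]
    unfolding sums_unique[OF scaled, symmetric] by (simp add: order.trans)
qed

end
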